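(* Let $n\ge 2$ be an integer, let $d$ be a nonzero complex number with $|d|\neq 1$, let $m\in\mathbb{N}$, let $p,q,r\in\mathbb{Z}$ with $r\neq 0$, and let $C\in\mathrm{GL}_n(\mathbb{C})$. (i) The action of $\mathrm{U}_n$ on $M_d^n/\mathbb{Z}_m$ given by $$A\{[z]\}=\left\{\left[e^{i\left(1+(p+\frac{q}{m})n\right)t}\,d^{\frac{nrt}{2\pi}}\,CBC^{-1}z\right]\right\},\qquad A=e^{it}\cdot B,\ t\in\mathbb{R},\ B\in\mathrm{SU}_n,$$ is effective if and only if there do not exist $\ell\in\mathbb{Z}$ and $K\in\{0,\dots,m-1\}$ such that both of the following conditions are satisfied: $$\frac{\ell}{r}\left(1+\left(p+\frac{q}{m}\right)n\right)-\frac{nK}{m}\in\mathbb{Z},\qquad \frac{\ell}{r}\left(p+\frac{q}{m}\right)-\frac{K}{m}\notin\mathbb{Z}.$$ (ii) The action of $\mathrm{U}_n$ on $M_d^n/\mathbb{Z}_m$ given by $$A\{[z]\}=\left\{\left[e^{i\left(-1+(p+\frac{q}{m})n\right)t}\,d^{\frac{nrt}{2\pi}}\,C\overline{B}C^{-1}z\right]\right\},\qquad A=e^{it}\cdot B,\ t\in\mathbb{R},\ B\in\mathrm{SU}_n,$$ is effective if and only if there do not exist $\ell\in\mathbb{Z}$ and $K\in\{0,\dots,m-1\}$ such that both of the following conditions are satisfied: $$\frac{\ell}{r}\left(-1+\left(p+\frac{q}{m}\right)n\right)-\frac{nK}{m}\in\mathbb{Z},\qquad \frac{\ell}{r}\l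eft(p+\frac{q}{m}\right)-\frac{K}{m}\notin\mathbb{Z}.$$
   Context: For a nonzero complex number $d$ with $|d|\neq 1$, the $n$-dimensional Hopf manifold $M_d^n$ is the compact complex manifold obtained from $\mathbb{C}^n\setminus\{0\}$ by identifying every point $z$ with $d\cdot z$ (hence with $d^k\cdot z$ for all $k\in\mathbb{Z}$); $[z]\in M_d^n$ denotes the equivalence class of $z\in\mathbb{C}^n\setminus\{0\}$. For $m\in\mathbb{N}$ (positive integers), $M_d^n/\mathbb{Z}_m$ denotes the compact complex manifold obtained from $M_d^n$ by identifying $[z]$ with $[e^{\frac{2\pi i}{m}}z]$ (hence with each $[e^{\frac{2\pi i K}{m}}z]$, $K=0,\dots,m-1$); $\{[z]\}\in M_d^n/\mathbb{Z}_m$ denotes the equivalence class of $[z]$. For $\mu\in\mathbb{R}$ set $d^{\mu}:=|d|^{\mu}e^{i\mu\arg d}$, where $\arg$ takes values in $[0,2\pi)$. $\overline{B}$ denotes the entrywise complex conjugate of the matrix $B$. Every $A\in\mathrm{U}_n$ can be written as $A=e^{it}\cdot B$ with $t\in\mathbb{R}$, $B\in\mathrm{SU}_n$; this representation is not unique, but the right-hand sides of the formulas do not depend on its choice. An action is effective if only the identity element acts trivially. *)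

theory Defs
  imports "HOL-Analysis.Analysis" "HOL-Algebra.Group_Action"
begin

section \<open>Unitary groups\<close>

definition conj_transpose :: "complex^'n^'n \<Rightarrow> complex^'n^'n" where
  "conj_transpose A = transpose (map_matrix cnj A)"

definition unitary_matrix :: "complex^'n^'n \<Rightarrow> bool" where
  "unitary_matrix A \<longleftrightarrow> conj_transpose A ** A = mat 1 \<and> A ** conj_transpose A = mat 1"

definition special_unitary_matrix :: "complex^'n^'n \<Rightarrow> bool" where
  "special_unitary_matrix A \<longleftrightarrow> unitary_matrix A \<and> det A = 1"

definition unitary_group :: "(complex^'n^'n) monoid" where
  "unitary_group = \<lparr>carrier = {A. unitary_matrix A}, mult = (**), one = mat 1\<rparr>"


section \<open>Hopf manifolds and their cyclic quotients, as sets of points\<close>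

definition hopf_rel :: "complex \<Rightarrow> ((complex^'n) \<times> (complex^'n)) set" where
  "hopf_rel d = {(z, w). z \<noteq> 0 \<and> w \<noteq> 0 \<and> (\<exists>k::int. w = (d powi k) *s z)}"

definition hopf :: "complex \<Rightarrow> (complex^'n) set set" where
  "hopf d = (UNIV - {0}) // hopf_rel d"

definition hopf_class :: "complex \<Rightarrow> complex^'n \<Rightarrow> (complex^'n) set" where
  "hopf_class d z = hopf_rel d `` {z}"

definition cyclic_rel :: "complex \<Rightarrow> nat \<Rightarrow> ((complex^'n) set \<times> (complex^'n) set) set" where
  "cyclic_rel d m = {(X, Y). \<exists>z K. z \<noteq> 0 \<and> K < m \<and> X = hopf_class d z \<and>
     Y = hopf_class d (cis (2 * pi * real K / real m) *s z)}"

definition hopf_quot :: "complex \<Rightarrow> nat \<Rightarrow> (complex^'n) set set set" where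
  "hopf_quot d m = hopf d // cyclic_rel d m"

definition hopf_quot_class :: "complex \<Rightarrow> nat \<Rightarrow> complex^'n \<Rightarrow> (complex^'n) set set" where
  "hopf_quot_class d m z = cyclic_rel d m `` {hopf_class d z}"


section \<open>The actions\<close>

text \<open>The real power \<open>d\<^sup>\<mu>\<close> is taken with the branch of the argument in \<open>[0, 2\<pi>)\<close>; the
  principal branch used by \<^term>\<open>(powr) :: complex \<Rightarrow> complex \<Rightarrow> complex\<close> has a different range.\<close>

definition real_cpow :: "complex \<Rightarrow> real \<Rightarrow> complex" where
  "real_cpow d \<mu> = of_real (norm d powr \<mu>) * cis (\<mu> * Arg2pi d)"

text \<open>\<open>induced_action d m F\<close> is the map given by \<open>A{[z]} = {[F t B z]}\<close> whenever
  \<open>A = e\<^sup>i\<^sup>t B\<close> with \<open>B\<close> special unitary. Note that \<open>mat c ** B\<close> is the scalar multiple \<open>c B\<close>. The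
  description below is definite only if the right-hand side depends neither on the choice of
  \<open>(t, B)\<close> nor on that of \<open>z\<close>; this, and the fact that one obtains an action of the unitary group,
  is proved at the end of this theory for the two families considered.\<close>

definition induced_action :: "complex \<Rightarrow> nat \<Rightarrow> (real \<Rightarrow> complex^'n^'n \<Rightarrow> complex^'n \<Rightarrow> complex^'n)
    \<Rightarrow> complex^'n^'n \<Rightarrow> (complex^'n) set set \<Rightarrow> (complex^'n) set set" where
  "induced_action d m F A = (\<lambda>X\<in>hopf_quot d m. THE Y. \<exists>t B z.
      special_unitary_matrix B \<and> A = mat (cis t) ** B \<and> z \<noteq> 0 \<and>
      X = hopf_quot_class d m z \<and> Y = hopf_quot_class d m (F t B z))"

definition unitary_action :: "complex \<Rightarrow> nat \<Rightarrow> int \<Rightarrow> int \<Rightarrow> int \<Rightarrow> complex^'n^'n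
    \<Rightarrow> complex^'n^'n \<Rightarrow> (complex^'n) set set \<Rightarrow> (complex^'n) set set" where
  "unitary_action d m p q r C = induced_action d m (\<lambda>t B z.
      (cis ((1 + (of_int p + of_int q / of_nat m) * real CARD('n)) * t)
        * real_cpow d (real CARD('n) * of_int r * t / (2 * pi)))
      *s ((C ** B ** matrix_inv C) *v z))"

definition unitary_action_cnj :: "complex \<Rightarrow> nat \<Rightarrow> int \<Rightarrow> int \<Rightarrow> int \<Rightarrow> complex^'n^'n
    \<Rightarrow> complex^'n^'n \<Rightarrow> (complex^'n) set set \<Rightarrow> (complex^'n) set set" where
  "unitary_action_cnj d m p q r C = induced_action d m (\<lambda>t B z.
      (cis ((- 1 + (of_int p + of_int q / of_nat m) * real CARD('n)) * t)
        * real_cpow d (real CARD('n) * of_int r * t / (2 * pi)))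
      *s ((C ** map_matrix cnj B ** matrix_inv C) *v z))"

definition effective_action :: "('g, 'b) monoid_scheme \<Rightarrow> 'x set \<Rightarrow> ('g \<Rightarrow> 'x \<Rightarrow> 'x) \<Rightarrow> bool" where
  "effective_action G E \<phi> \<longleftrightarrow> group_action G E \<phi> \<and>
     (\<forall>g\<in>carrier G. (\<forall>x\<in>E. \<phi> g x = x) \<longrightarrow> g = \<one>\<^bsub>G\<^esub>)"

lemma effective_action_iff_faithful_action:
  "effective_action G E \<phi> \<longleftrightarrow> faithful_action G E \<phi>"
proof (cases "group_action G E \<phi>")
  case True
  interpret group_action G E \<phi> by (rule True)
  interpret group_hom G "BijGroup E" \<phi> by (rule group_hom)
  have *: "(\<forall>x\<in>E. \<phi> g x = x) \<longleftrightarrow> \<phi> g = \<one>\<^bsub>BijGroup E\<^esub>" if "g \<in> carrier G" for g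
  proof
    assume "\<forall>x\<in>E. \<phi> g x = x"
    moreover have "\<phi> g \<in> extensional E"
      using bij_prop0[OF that] by (simp add: Bij_def)
    ultimately show "\<phi> g = \<one>\<^bsub>BijGroup E\<^esub>"
      by (auto simp: BijGroup_def extensional_def)
  qed (auto simp: BijGroup_def)
  have "effective_action G E \<phi> \<longleftrightarrow> inj_on \<phi> (carrier G)"
    unfolding effective_action_def inj_on_one_iff using True * by auto
  then show ?thesis
    using True by (simp add: faithful_action_def faithful_action_axioms_def)
qed (simp add: effective_action_def faithful_action_def)


section \<open>Well-definedness of the actions\<close>

lemma mat_mult_vec [simp]: "mat c *v z = c *s (z :: complex^'n)"
  by (simp add: matrix_vector_mult_def mat_def vec_eq_iff if_distrib if_distribR cong: if_cong)

lemma matrix_eqI: "(\<And>z. A *v z = B *v z) \<Longrightarrow> A = (B :: complex^'n^'n)"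
  by (simp add: matrix_eq)

lemma mat_mult_mat: "mat a ** mat b = (mat (a * b) :: complex^'n^'n)"
  by (rule matrix_eqI) (simp add: matrix_vector_mul_assoc[symmetric])

lemma mat_commute: "mat a ** B = (B :: complex^'n^'n) ** mat a"
  by (rule matrix_eqI) (simp add: matrix_vector_mul_assoc[symmetric] vector_scalar_commute)

lemma det_mat: "det (mat c :: complex^'n^'n) = c ^ CARD('n)"
  by (subst det_diagonal) (auto simp: mat_def)

lemma det_map_cnj: "det (map_matrix cnj A) = cnj (det A)"
  by (simp add: det_def)

lemma map_cnj_mult: "map_matrix cnj (A ** B) = map_matrix cnj A ** map_matrix cnj B"
  by (simp add: vec_eq_iff matrix_matrix_mult_def)

lemma map_cnj_mat: "map_matrix cnj (mat c :: complex^'n^'n) = mat (cnj c)"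
  by (simp add: vec_eq_iff mat_def)

lemma conj_transpose_mult: "conj_transpose (A ** B) = conj_transpose B ** conj_transpose A"
  by (simp add: conj_transpose_def map_cnj_mult matrix_transpose_mul)

lemma conj_transpose_mat [simp]: "conj_transpose (mat c :: complex^'n^'n) = mat (cnj c)"
  by (simp add: conj_transpose_def map_cnj_mat)

lemma conj_transpose_conj_transpose [simp]: "conj_transpose (conj_transpose A) = A"
  by (simp add: conj_transpose_def vec_eq_iff transpose_def)

lemma unitary_mult: "unitary_matrix A \<Longrightarrow> unitary_matrix B \<Longrightarrow> unitary_matrix (A ** B)"
  unfolding unitary_matrix_def conj_transpose_mult
  by (metis matrix_mul_assoc matrix_mul_lid)

lemma unitary_conj_transpose: "unitary_matrix A \<Longrightarrow> unitary_matrix (conj_transpose A)"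
  by (simp add: unitary_matrix_def)

lemma unitary_mat_cis: "unitary_matrix (mat (cis t) :: complex^'n^'n)"
  by (simp add: unitary_matrix_def mat_mult_mat cis_cnj cis_mult)

lemma norm_det_unitary:
  assumes "unitary_matrix A"
  shows "norm (det A) = 1"
proof -
  have "det (conj_transpose A ** A) = 1"
    using assms by (simp add: unitary_matrix_def)
  then have "cnj (det A) * det A = 1"
    by (simp add: det_mul conj_transpose_def det_map_cnj)
  then have "norm (det A) * norm (det A) = 1"
    by (metis complex_mod_cnj norm_mult norm_one)
  then show ?thesis
    by (metis abs_norm_cancel abs_square_eq_1 power2_eq_square)
qed

lemma group_unitary_group: "group unitary_group"
proof (rule groupI)
  fix A :: "complex^'n^'n" assume "A \<in> carrier unitary_group"
  then show "\<exists>B\<in>carrier unitary_group. B \<otimes>\<^bsub>unitary_group\<^esub> A = \<one>\<^bsub>unitary_group\<^esub>"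
    by (intro bexI[of _ "conj_transpose A"])
      (auto simp: unitary_group_def unitary_conj_transpose unitary_matrix_def)
qed (auto simp: unitary_group_def unitary_mult matrix_mul_assoc unitary_mat_cis[of 0, simplified])

lemma special_unitary_mult:
  "special_unitary_matrix A \<Longrightarrow> special_unitary_matrix B \<Longrightarrow> special_unitary_matrix (A ** B)"
  by (simp add: special_unitary_matrix_def unitary_mult det_mul)

lemma special_unitary_one: "special_unitary_matrix (mat 1)"
  using unitary_mat_cis[of 0] by (simp add: special_unitary_matrix_def)

lemma unitary_decomposition:
  fixes A :: "complex^'n^'n"
  assumes "unitary_matrix A"
  obtains t B where "special_unitary_matrix B" "A = mat (cis t) ** B"
proof -
  define t where "t = Arg2pi (det A) / CARD('n)"
  have "det A = cis (Arg2pi (det A))"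
    using Arg2pi_eq[of "det A"] norm_det_unitary[OF assms] by (simp add: cis_conv_exp)
  also have "\<dots> = cis t ^ CARD('n)"
    unfolding Complex.DeMoivre by (simp add: t_def)
  finally have d: "det A = cis t ^ CARD('n)" .
  show thesis
  proof (rule that)
    show "A = mat (cis t) ** (mat (cis (- t)) ** A)"
      by (simp add: matrix_mul_assoc mat_mult_mat cis_mult)
    show "special_unitary_matrix (mat (cis (- t)) ** A)"
      using assms by (simp add: special_unitary_matrix_def unitary_mult unitary_mat_cis
          det_mul det_mat d cis_mult flip: power_mult_distrib)
  qed
qed

lemma decomposition_unique:
  fixes B B' :: "complex^'n^'n"
  assumes "special_unitary_matrix B" "special_unitary_matrix B'"
    and "mat (cis t) ** B = mat (cis t') ** B'"
  obtains k :: int where "t = t' + 2 * pi * k / CARD('n)"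
    and "B' = mat (cis (2 * pi * k / CARD('n))) ** B"
proof -
  have "mat (cis (- t')) ** (mat (cis t) ** B) = mat (cis (- t')) ** (mat (cis t') ** B')"
    using assms by simp
  then have B': "B' = mat (cis (t - t')) ** B"
    by (simp add: matrix_mul_assoc mat_mult_mat cis_mult)
  then have "det B' = cis (t - t') ^ CARD('n) * det B"
    by (simp add: det_mul det_mat)
  then have "cis (CARD('n) * (t - t')) = 1"
    using assms by (simp add: special_unitary_matrix_def flip: Complex.DeMoivre)
  then have "cos (CARD('n) * (t - t')) = 1"
    by (metis cis.sel(1) one_complex.sel(1))
  then obtain k :: int where "CARD('n) * (t - t') = k * 2 * pi"
    by (auto simp: cos_one_2pi_int)
  then have "t - t' = 2 * pi * k / CARD('n)"
    by (simp add: field_simps)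
  then show thesis
    using that[of k] B' by (simp add: algebra_simps)
qed

lemma real_cpow_add: "d \<noteq> 0 \<Longrightarrow> real_cpow d (a + b) = real_cpow d a * real_cpow d b"
  by (simp add: real_cpow_def powr_add distrib_right flip: cis_mult)

lemma real_cpow_int:
  assumes "d \<noteq> 0"
  shows "real_cpow d (of_int k) = d powi k"
proof -
  have d: "d = of_real (norm d) * cis (Arg2pi d)"
    using Arg2pi_eq[of d] by (simp add: cis_conv_exp)
  have "d powi k = of_real (norm d) powi k * cis (Arg2pi d) powi k"
    by (subst d) (rule power_int_mult_distrib)
  then show ?thesis
    using assms by (simp add: real_cpow_def cis_power_int powr_real_of_int' of_real_power_int)
qed

lemma real_cpow_nonzero: "d \<noteq> 0 \<Longrightarrow> real_cpow d a \<noteq> 0"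
  by (simp add: real_cpow_def)

lemma equiv_hopf_rel:
  assumes "d \<noteq> 0"
  shows "equiv (UNIV - {0}) (hopf_rel d)"
proof (rule equivI)
  show "hopf_rel d \<subseteq> (UNIV - {0}) \<times> (UNIV - {0})"
    by (auto simp: hopf_rel_def)
  show "refl_on (UNIV - {0}) (hopf_rel d)"
    by (auto simp: hopf_rel_def refl_on_def intro: exI[of _ 0])
  show "sym (hopf_rel d)"
  proof (rule symI)
    fix z w :: "complex^'n" assume "(z, w) \<in> hopf_rel d"
    then obtain k :: int where k: "z \<noteq> 0" "w \<noteq> 0" "w = (d powi k) *s z"
      by (auto simp: hopf_rel_def)
    then have "z = (d powi (- k)) *s w"
      using assms by (simp add: vector_smult_assoc power_int_minus)
    then show "(w, z) \<in> hopf_rel d"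
      using k unfolding hopf_rel_def by blast
  qed
  show "trans (hopf_rel d)"
  proof (rule transI)
    fix x y z :: "complex^'n" assume "(x, y) \<in> hopf_rel d" "(y, z) \<in> hopf_rel d"
    then obtain k l :: int where "x \<noteq> 0" "z \<noteq> 0" "y = (d powi k) *s x" "z = (d powi l) *s y"
      by (auto simp: hopf_rel_def)
    moreover from this have "z = (d powi (l + k)) *s x"
      using assms by (simp add: vector_smult_assoc power_int_add)
    ultimately show "(x, z) \<in> hopf_rel d"
      unfolding hopf_rel_def by blast
  qed
qed

lemma hopf_class_eq_iff:
  assumes "d \<noteq> 0" "z \<noteq> 0" "w \<noteq> 0"
  shows "hopf_class d z = hopf_class d w \<longleftrightarrow> (\<exists>k::int. w = (d powi k) *s z)"
  using eq_equiv_class_iff[OF equiv_hopf_rel[OF assms(1)], of z w] assms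
  by (auto simp: hopf_class_def hopf_rel_def)

lemma hopf_eq: "hopf d = hopf_class d ` (UNIV - {0})"
  by (auto simp: hopf_def hopf_class_def quotient_def)

lemma cis_mod:
  assumes "m > 0"
  shows "cis (2 * pi * real (nat (K mod int m)) / real m) = cis (2 * pi * of_int K / real m)"
proof -
  have "real_of_int K = of_int (K div int m) * real m + of_int (K mod int m)"
    by (metis div_mult_mod_eq of_int_add of_int_mult of_int_of_nat_eq)
  then have "2 * pi * of_int K / real m
      = 2 * pi * of_int (K div int m) + 2 * pi * real (nat (K mod int m)) / real m"
    using assms by (simp add: field_simps)
  then show ?thesis
    by (simp only:) (simp flip: cis_mult)
qed

lemma cyclic_rel_iff:
  assumes "d \<noteq> 0" "m > 0" "z \<noteq> 0" "w \<noteq> 0"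
  shows "(hopf_class d z, hopf_class d w) \<in> cyclic_rel d m \<longleftrightarrow>
    (\<exists>k K :: int. w = ((d powi k) * cis (2 * pi * of_int K / real m)) *s z)"
proof
  assume "(hopf_class d z, hopf_class d w) \<in> cyclic_rel d m"
  then obtain u K where u: "u \<noteq> 0" "hopf_class d z = hopf_class d u"
      "hopf_class d w = hopf_class d (cis (2 * pi * real K / real m) *s u)"
    by (auto simp: cyclic_rel_def)
  from u obtain j :: int where j: "u = (d powi j) *s z"
    using hopf_class_eq_iff[of d z u] assms by auto
  obtain l :: int where l: "w = (d powi l) *s (cis (2 * pi * real K / real m) *s u)"
    using hopf_class_eq_iff[of d "cis (2 * pi * real K / real m) *s u" w] assms u by auto
  have "w = ((d powi (l + j)) * cis (2 * pi * of_int (int K) / real m)) *s z"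
    using assms by (simp add: j l vector_smult_assoc power_int_add mult_ac)
  then show "\<exists>k K :: int. w = ((d powi k) * cis (2 * pi * of_int K / real m)) *s z"
    by blast
next
  assume "\<exists>k K :: int. w = ((d powi k) * cis (2 * pi * of_int K / real m)) *s z"
  then obtain k K :: int where w: "w = ((d powi k) * cis (2 * pi * of_int K / real m)) *s z"
    by blast
  define L where "L = nat (K mod int m)"
  have L: "L < m" "cis (2 * pi * of_int K / real m) = cis (2 * pi * real L / real m)"
    using assms cis_mod[of m K] by (auto simp: L_def nat_less_iff)
  have "hopf_class d (cis (2 * pi * real L / real m) *s z) = hopf_class d w"
    using assms w by (subst hopf_class_eq_iff) (auto simp: L vector_smult_assoc)
  then show "(hopf_class d z, hopf_class d w) \<in> cyclic_rel d m"
    using assms L by (auto simp: cyclic_rel_def)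
qed

lemma equiv_cyclic_rel:
  fixes d :: complex
  assumes "d \<noteq> 0" "m > 0"
  shows "equiv (hopf d :: (complex^'n) set set) (cyclic_rel d m)"
proof (rule equivI)
  show sub: "cyclic_rel d m \<subseteq> hopf d \<times> (hopf d :: (complex^'n) set set)"
    by (auto simp: cyclic_rel_def hopf_eq)
  show "refl_on (hopf d :: (complex^'n) set set) (cyclic_rel d m)"
    using assms by (auto simp: refl_on_def hopf_eq cyclic_rel_iff intro!: exI[of _ 0])
  have "(Y, X) \<in> cyclic_rel d m" if "(X, Y) \<in> cyclic_rel d m" for X Y :: "(complex^'n) set"
  proof -
    from that sub obtain z w where zw: "z \<noteq> 0" "w \<noteq> 0" "X = hopf_class d z" "Y = hopf_class d w"
      by (force simp: hopf_eq)
    with that assms obtain k K :: int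
      where w: "w = ((d powi k) * cis (2 * pi * of_int K / real m)) *s z"
      by (auto simp: cyclic_rel_iff)
    have "((d powi (- k)) * cis (2 * pi * of_int (- K) / real m))
        * ((d powi k) * cis (2 * pi * of_int K / real m)) = 1"
      using assms by (simp add: power_int_minus field_simps cis_mult)
    then have "z = ((d powi (- k)) * cis (2 * pi * of_int (- K) / real m)) *s w"
      by (simp only: w vector_smult_assoc vector_smult_lid)
    then show ?thesis
      using zw assms cyclic_rel_iff[of d m w z] by blast
  qed
  then show "sym (cyclic_rel d m :: ((complex^'n) set \<times> _) set)"
    by (rule symI)
  have "(X, Z) \<in> cyclic_rel d m" if XY: "(X, Y) \<in> cyclic_rel d m" and YZ: "(Y, Z) \<in> cyclic_rel d m"
    for X Y Z :: "(complex^'n) set"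
  proof -
    obtain x y where xy: "x \<noteq> 0" "y \<noteq> 0" "X = hopf_class d x" "Y = hopf_class d y"
      using XY sub by (force simp: hopf_eq)
    obtain z where z: "z \<noteq> 0" "Z = hopf_class d z"
      using YZ sub by (force simp: hopf_eq)
    obtain k K :: int where 1: "y = ((d powi k) * cis (2 * pi * of_int K / real m)) *s x"
      using XY xy assms by (auto simp: cyclic_rel_iff)
    obtain l L :: int where 2: "z = ((d powi l) * cis (2 * pi * of_int L / real m)) *s y"
      using YZ xy z assms by (auto simp: cyclic_rel_iff)
    have "z = ((d powi (l + k)) * cis (2 * pi * of_int (L + K) / real m)) *s x"
      using assms by (simp add: 1 2 vector_smult_assoc power_int_add distrib_left add_divide_distrib
          mult_ac flip: cis_mult)
    then show ?thesis
      using xy z assms cyclic_rel_iff[of d m x z] by blast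
  qed
  then show "trans (cyclic_rel d m :: ((complex^'n) set \<times> _) set)"
    by (rule transI)
qed

lemma hopf_quot_class_eq_iff:
  assumes "d \<noteq> 0" "m > 0" "z \<noteq> 0" "w \<noteq> 0"
  shows "hopf_quot_class d m z = hopf_quot_class d m w \<longleftrightarrow>
    (\<exists>k K :: int. w = ((d powi k) * cis (2 * pi * of_int K / real m)) *s z)"
proof -
  have "hopf_class d z \<in> hopf d" "hopf_class d w \<in> hopf d"
    using assms by (auto simp: hopf_eq)
  then have "hopf_quot_class d m z = hopf_quot_class d m w \<longleftrightarrow>
      (hopf_class d z, hopf_class d w) \<in> cyclic_rel d m"
    unfolding hopf_quot_class_def
    by (rule eq_equiv_class_iff[OF equiv_cyclic_rel[OF assms(1,2)]])
  then show ?thesis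
    using assms by (simp add: cyclic_rel_iff)
qed

lemma hopf_quot_eq: "hopf_quot d m = hopf_quot_class d m ` (UNIV - {0})"
  by (auto simp: hopf_quot_def hopf_quot_class_def quotient_def hopf_eq)

locale twisted_action =
  fixes d :: complex and m :: nat and g :: "real \<Rightarrow> complex"
    and D :: "complex^'n^'n \<Rightarrow> complex^'n^'n" and \<epsilon> :: real
  assumes d: "d \<noteq> 0" and m: "m > 0"
    and g_nonzero: "\<And>t. g t \<noteq> 0" and g_add: "\<And>s t. g (s + t) = g s * g t"
    and D_mult: "\<And>A B. D (A ** B) = D A ** D B"
    and D_scalar: "\<And>t. D (mat (cis t)) = mat (cis (\<epsilon> * t))"
    and g_period: "\<And>k::int. \<exists>j K :: int. g (2 * pi * k / CARD('n)) =
        ((d powi j) * cis (2 * pi * of_int K / real m)) * cis (\<epsilon> * (2 * pi * k / CARD('n)))"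
begin

abbreviation F :: "real \<Rightarrow> complex^'n^'n \<Rightarrow> complex^'n \<Rightarrow> complex^'n" where
  "F t B z \<equiv> g t *s (D B *v z)"

lemma D_one: "D (mat 1) = mat 1"
  using D_scalar[of 0] by simp

lemma F_nonzero:
  assumes "special_unitary_matrix B" "z \<noteq> 0"
  shows "F t B z \<noteq> 0"
proof
  assume "F t B z = 0"
  then have "D B *v z = 0"
    using g_nonzero by simp
  then have "D (conj_transpose B) *v (D B *v z) = 0"
    by simp
  then show False
    using assms by (simp add: matrix_vector_mul_assoc special_unitary_matrix_def
        unitary_matrix_def D_one flip: D_mult)
qed

lemma F_scale: "F t B (c *s z) = c *s F t B z"
  by (simp add: vector_scalar_commute vector_smult_assoc mult_ac)

lemma F_mult: "F (t + t') (B ** B') z = F t B (F t' B' z)"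
  by (simp add: g_add D_mult vector_scalar_commute vector_smult_assoc matrix_vector_mul_assoc)

lemma well_defined:
  assumes B: "special_unitary_matrix B" "special_unitary_matrix B'"
    and A: "mat (cis t) ** B = mat (cis t') ** B'"
    and z: "z \<noteq> 0" "z' \<noteq> 0" "hopf_quot_class d m z = hopf_quot_class d m z'"
  shows "hopf_quot_class d m (F t B z) = hopf_quot_class d m (F t' B' z')"
proof -
  obtain a b :: int where ab: "z' = ((d powi a) * cis (2 * pi * of_int b / real m)) *s z"
    using z d m by (auto simp: hopf_quot_class_eq_iff)
  have 1: "hopf_quot_class d m (F t B z) = hopf_quot_class d m (F t B z')"
    using z B d m F_nonzero by (subst hopf_quot_class_eq_iff) (auto simp: ab F_scale)
  obtain k :: int where k: "t = t' + 2 * pi * k / CARD('n)"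
      "B' = mat (cis (2 * pi * k / CARD('n))) ** B"
    using decomposition_unique[OF B A] by blast
  obtain j K :: int where jK: "g (2 * pi * k / CARD('n)) =
      ((d powi j) * cis (2 * pi * of_int K / real m)) * cis (\<epsilon> * (2 * pi * k / CARD('n)))"
    using g_period by blast
  have "F t B z' = ((d powi j) * cis (2 * pi * of_int K / real m)) *s F t' B' z'"
    unfolding k(2) D_mult D_scalar k(1) g_add jK
    by (simp add: vector_smult_assoc mult_ac flip: matrix_vector_mul_assoc)
  then have "hopf_quot_class d m (F t' B' z') = hopf_quot_class d m (F t B z')"
    using z B d m F_nonzero by (subst hopf_quot_class_eq_iff) auto
  with 1 show ?thesis by simp
qed

lemma induced_action_eq:
  assumes "special_unitary_matrix B" "z \<noteq> 0"
  shows "induced_action d m F (mat (cis t) ** B) (hopf_quot_class d m z)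
    = hopf_quot_class d m (F t B z)"
proof -
  have "(THE Y. \<exists>t' B' z'. special_unitary_matrix B' \<and> mat (cis t) ** B = mat (cis t') ** B' \<and>
      z' \<noteq> 0 \<and> hopf_quot_class d m z = hopf_quot_class d m z' \<and>
      Y = hopf_quot_class d m (F t' B' z')) = hopf_quot_class d m (F t B z)"
    by (rule the_equality) (use assms well_defined in \<open>blast, metis\<close>)
  then show ?thesis
    using assms by (simp add: induced_action_def hopf_quot_eq)
qed

lemma induced_action_closed:
  assumes "unitary_matrix A" "X \<in> hopf_quot d m"
  shows "induced_action d m F A X \<in> hopf_quot d m"
proof -
  obtain t B where "special_unitary_matrix B" "A = mat (cis t) ** B"
    using unitary_decomposition[OF assms(1)] .
  with assms(2) show ?thesis
    using F_nonzero[of B] by (auto simp: hopf_quot_eq induced_action_eq)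
qed

lemma induced_action_one: "X \<in> hopf_quot d m \<Longrightarrow> induced_action d m F (mat 1) X = X"
  using induced_action_eq[OF special_unitary_one, of _ 0] g_add[of 0 0] g_nonzero[of 0]
  by (auto simp: hopf_quot_eq D_one)

lemma induced_action_mult:
  assumes "unitary_matrix A" "unitary_matrix A'" "X \<in> hopf_quot d m"
  shows "induced_action d m F (A ** A') X = induced_action d m F A (induced_action d m F A' X)"
proof -
  obtain t B where B: "special_unitary_matrix B" "A = mat (cis t) ** B"
    using unitary_decomposition[OF assms(1)] .
  obtain t' B' where B': "special_unitary_matrix B'" "A' = mat (cis t') ** B'"
    using unitary_decomposition[OF assms(2)] .
  obtain z where z: "z \<noteq> 0" "X = hopf_quot_class d m z"
    using assms(3) by (auto simp: hopf_quot_eq)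
  have "A ** A' = mat (cis t) ** (B ** mat (cis t')) ** B'"
    by (simp add: B B' matrix_mul_assoc)
  also have "\<dots> = mat (cis (t + t')) ** (B ** B')"
    by (simp add: matrix_mul_assoc mat_mult_mat cis_mult flip: mat_commute[of "cis t'" B])
  finally have AA': "A ** A' = mat (cis (t + t')) ** (B ** B')" .
  have "induced_action d m F (A ** A') X = hopf_quot_class d m (F (t + t') (B ** B') z)"
    unfolding AA' z(2) by (rule induced_action_eq) (use B B' z special_unitary_mult in auto)
  also have "\<dots> = hopf_quot_class d m (F t B (F t' B' z))"
    by (simp only: F_mult)
  also have "\<dots> = induced_action d m F A (induced_action d m F A' X)"
    unfolding B(2) B'(2) z(2)
    by (simp only: induced_action_eq[OF B'(1) z(1)] induced_action_eq[OF B(1) F_nonzero[OF B'(1) z(1)]])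
  finally show ?thesis .
qed

lemma group_action_induced: "group_action unitary_group (hopf_quot d m) (induced_action d m F)"
proof -
  let ?E = "hopf_quot d m :: (complex^'n) set set set"
  let ?a = "induced_action d m F"
  have bij: "?a A \<in> Bij ?E" if A: "unitary_matrix A" for A
  proof -
    have inv: "?a A (?a (conj_transpose A) X) = X" "?a (conj_transpose A) (?a A X) = X" if "X \<in> ?E" for X
      using induced_action_mult[OF A unitary_conj_transpose[OF A] that]
        induced_action_mult[OF unitary_conj_transpose[OF A] A that]
        induced_action_one[OF that] A by (simp_all add: unitary_matrix_def)
    have "bij_betw (?a A) ?E ?E"
      by (rule bij_betw_byWitness[where f' = "?a (conj_transpose A)"])
        (use inv induced_action_closed[OF A] induced_action_closed[OF unitary_conj_transpose[OF A]] in auto)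
    moreover have "?a A \<in> extensional ?E"
      by (simp add: induced_action_def)
    ultimately show ?thesis by (simp add: Bij_def)
  qed
  have "?a \<in> hom unitary_group (BijGroup ?E)"
  proof (rule homI)
    fix A :: "complex^'n^'n" assume "A \<in> carrier unitary_group"
    then show "?a A \<in> carrier (BijGroup ?E)"
      using bij by (simp add: unitary_group_def BijGroup_def)
  next
    fix A A' :: "complex^'n^'n" assume "A \<in> carrier unitary_group" "A' \<in> carrier unitary_group"
    then have A: "unitary_matrix A" "unitary_matrix A'"
      by (auto simp: unitary_group_def)
    have "?a (A ** A') = compose ?E (?a A) (?a A')"
    proof
      fix X show "?a (A ** A') X = compose ?E (?a A) (?a A') X"
        by (cases "X \<in> ?E") (simp_all add: compose_def induced_action_mult A, simp add: induced_action_def)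
    qed
    then show "?a (A \<otimes>\<^bsub>unitary_group\<^esub> A') = ?a A \<otimes>\<^bsub>BijGroup ?E\<^esub> ?a A'"
      using A bij by (simp add: unitary_group_def BijGroup_def)
  qed
  then show ?thesis
    by (intro group_action.intro group_hom.intro group_hom_axioms.intro group_unitary_group group_BijGroup)
qed

end

lemma conjugation_mult:
  fixes C :: "complex^'n^'n"
  assumes "invertible C"
  shows "C ** (A ** B) ** matrix_inv C = (C ** A ** matrix_inv C) ** (C ** B ** matrix_inv C)"
proof -
  have "matrix_inv C ** C = mat 1"
    using assms unfolding invertible_def matrix_inv_def
    by (metis (mono_tags, lifting) someI_ex)
  then have "A ** matrix_inv C ** C = A"
    by (metis matrix_mul_assoc matrix_mul_rid)
  then show ?thesis
    by (metis matrix_mul_assoc)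
qed

lemma conjugation_mat:
  fixes C :: "complex^'n^'n"
  assumes "invertible C"
  shows "C ** mat c ** matrix_inv C = mat c"
proof -
  have "C ** matrix_inv C = mat 1"
    using assms unfolding invertible_def matrix_inv_def
    by (metis (mono_tags, lifting) someI_ex)
  then show ?thesis
    by (metis mat_commute matrix_mul_assoc matrix_mul_rid)
qed

lemma twist_period:
  fixes \<epsilon> :: real and k :: int
  assumes "d \<noteq> 0" "m > 0"
  shows "\<exists>j K :: int. cis ((\<epsilon> + (of_int p + of_int q / of_nat m) * real CARD('n)) * (2 * pi * k / CARD('n)))
      * real_cpow d (real CARD('n) * of_int r * (2 * pi * k / CARD('n)) / (2 * pi)) =
      ((d powi j) * cis (2 * pi * of_int K / real m)) * cis (\<epsilon> * (2 * pi * k / CARD('n::finite)))"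
proof -
  have 1: "(\<epsilon> + (of_int p + of_int q / of_nat m) * real CARD('n)) * (2 * pi * k / CARD('n))
      = \<epsilon> * (2 * pi * k / CARD('n)) + 2 * pi * of_int (p * k) + 2 * pi * of_int (q * k) / real m"
    using assms by (simp add: field_simps)
  have 2: "real CARD('n) * of_int r * (2 * pi * k / CARD('n)) / (2 * pi) = of_int (r * k)"
    by simp
  show ?thesis
    unfolding 1 2 real_cpow_int[OF assms(1)]
    by (intro exI[of _ "r * k"] exI[of _ "q * k"]) (simp del: of_int_mult flip: cis_mult)
qed

lemma twist_add:
  assumes "d \<noteq> 0"
  shows "cis (a * (s + t)) * real_cpow d (b * (s + t) / (2 * pi)) =
    (cis (a * s) * real_cpow d (b * s / (2 * pi))) * (cis (a * t) * real_cpow d (b * t / (2 * pi)))"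
  using real_cpow_add[OF assms] by (simp add: distrib_left add_divide_distrib mult_ac flip: cis_mult)

lemma twisted_action1:
  fixes C :: "complex^'n^'n"
  assumes "d \<noteq> 0" "m > 0" "invertible C"
  shows "twisted_action d m
    (\<lambda>t. cis ((1 + (of_int p + of_int q / of_nat m) * real CARD('n)) * t)
        * real_cpow d (real CARD('n) * of_int r * t / (2 * pi)))
    (\<lambda>B. C ** B ** matrix_inv C) 1"
proof (unfold_locales, goal_cases)
  case (4 s t)
  show ?case by (rule twist_add[OF assms(1)])
next
  case (7 k)
  show ?case by (rule twist_period[OF assms(1,2)])
qed (use assms in \<open>auto simp: real_cpow_nonzero conjugation_mult conjugation_mat\<close>)

lemma twisted_action2:
  fixes C :: "complex^'n^'n"
  assumes "d \<noteq> 0" "m > 0" "invertible C"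
  shows "twisted_action d m
    (\<lambda>t. cis ((- 1 + (of_int p + of_int q / of_nat m) * real CARD('n)) * t)
        * real_cpow d (real CARD('n) * of_int r * t / (2 * pi)))
    (\<lambda>B. C ** map_matrix cnj B ** matrix_inv C) (- 1)"
proof (unfold_locales, goal_cases)
  case (4 s t)
  show ?case by (rule twist_add[OF assms(1)])
next
  case (7 k)
  show ?case by (rule twist_period[OF assms(1,2)])
qed (use assms in \<open>auto simp: real_cpow_nonzero conjugation_mult conjugation_mat map_cnj_mult
    map_cnj_mat cis_cnj\<close>)

theorem unitary_action_eq:
  fixes C :: "complex^'n^'n"
  assumes "d \<noteq> 0" "m > 0" "invertible C" "special_unitary_matrix B" "z \<noteq> 0"
  shows "unitary_action d m p q r C (mat (cis t) ** B) (hopf_quot_class d m z) = hopf_quot_class d m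
    ((cis ((1 + (of_int p + of_int q / of_nat m) * real CARD('n)) * t)
        * real_cpow d (real CARD('n) * of_int r * t / (2 * pi)))
      *s ((C ** B ** matrix_inv C) *v z))"
  unfolding unitary_action_def
  by (rule twisted_action.induced_action_eq[OF twisted_action1[OF assms(1-3)] assms(4,5)])

theorem unitary_action_cnj_eq:
  fixes C :: "complex^'n^'n"
  assumes "d \<noteq> 0" "m > 0" "invertible C" "special_unitary_matrix B" "z \<noteq> 0"
  shows "unitary_action_cnj d m p q r C (mat (cis t) ** B) (hopf_quot_class d m z) = hopf_quot_class d m
    ((cis ((- 1 + (of_int p + of_int q / of_nat m) * real CARD('n)) * t)
        * real_cpow d (real CARD('n) * of_int r * t / (2 * pi)))
      *s ((C ** map_matrix cnj B ** matrix_inv C) *v z))"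
  unfolding unitary_action_cnj_def
  by (rule twisted_action.induced_action_eq[OF twisted_action2[OF assms(1-3)] assms(4,5)])

theorem group_action_unitary_action:
  fixes C :: "complex^'n^'n"
  assumes "d \<noteq> 0" "m > 0" "invertible C"
  shows "group_action unitary_group (hopf_quot d m) (unitary_action d m p q r C)"
  unfolding unitary_action_def by (rule twisted_action.group_action_induced[OF twisted_action1[OF assms]])

theorem group_action_unitary_action_cnj:
  fixes C :: "complex^'n^'n"
  assumes "d \<noteq> 0" "m > 0" "invertible C"
  shows "group_action unitary_group (hopf_quot d m) (unitary_action_cnj d m p q r C)"
  unfolding unitary_action_cnj_def by (rule twisted_action.group_action_induced[OF twisted_action2[OF assms]])

end

theory Submission
  imports Defs "HOL-Library.Real_Mod"
begin

text \<open>An element \<open>A = e\<^sup>i\<^sup>t B\<close> acts trivially iff every nonzero vector is an eigenvector of the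
  linear map inducing its action, with eigenvalue in the group generated by \<open>d\<close> and \<open>e\<^sup>2\<^sup>\<pi>\<^sup>i\<^sup>/\<^sup>m\<close>;
  that map, hence also \<open>B\<close>, is then scalar, say \<open>B = e\<^sup>2\<^sup>\<pi>\<^sup>i\<^sup>j\<^sup>/\<^sup>n\<close>, and the eigenvalue is some
  \<open>d\<^sup>\<ell> e\<^sup>2\<^sup>\<pi>\<^sup>i\<^sup>K\<^sup>/\<^sup>m\<close>. Comparing moduli gives \<open>t = 2\<pi>\<ell>/(nr)\<close>. With \<open>\<epsilon> = \<plusminus>1\<close>, \<open>s = p + q/m\<close> and
  \<open>x = \<ell>(\<epsilon> + sn)/(nr) - K/m\<close>, comparing arguments gives \<open>x + \<epsilon>j/n \<in> \<int>\<close>, which has a solution \<open>j\<close>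
  iff \<open>nx \<in> \<int>\<close>. Finally \<open>A = 1\<close> iff \<open>\<ell>/(nr) + j/n \<in> \<int>\<close>, equivalently
  \<open>x - \<epsilon>\<ell>/(nr) = \<ell>s/r - K/m \<in> \<int>\<close>.\<close>

section \<open>Roots of unity and scalar matrices\<close>

lemma cis_2pi_eq_1_iff: "cis (2 * pi * x) = 1 \<longleftrightarrow> x \<in> \<int>"
  by (auto simp: cis_eq_1_iff Ints_def)

lemma mat_eq_iff: "mat a = (mat b :: 'a::zero^'n^'n) \<longleftrightarrow> a = b"
  by (force simp: vec_eq_iff mat_def)

lemma cis_2pi_eq_iff: "cis (2 * pi * x) = cis (2 * pi * y) \<longleftrightarrow> x - y \<in> \<int>"
proof -
  have "cis (2 * pi * x) = cis (2 * pi * (x - y)) * cis (2 * pi * y)"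
    by (simp add: cis_mult right_diff_distrib)
  then show ?thesis
    by (simp add: cis_2pi_eq_1_iff[symmetric])
qed

text \<open>The eigenvalue may a priori vary with \<open>z\<close>. The basis vectors make
  \<open>M\<close> diagonal, and the all-ones vector \<open>vec 1\<close> forces every diagonal
  entry to equal its own eigenvalue, which lies in \<open>S\<close>.\<close>

lemma matrix_eq_mat_of_eigenvectors:
  fixes M :: "'a::field^'n^'n"
  assumes "\<And>z. z \<noteq> 0 \<Longrightarrow> \<exists>c\<in>S. M *v z = c *s z"
  shows "\<exists>c\<in>S. M = mat c"
proof -
  have "\<exists>c. M *v axis j 1 = c *s axis j 1" for j
    using assms[of "axis j 1"] by (auto simp: axis_eq_0_iff)
  then obtain c where c: "M *v axis j 1 = c j *s axis j 1" for j
    by metis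
  have M: "M $ i $ j = (if i = j then c j else 0)" for i j
    using arg_cong[OF c[of j], of "\<lambda>v. v $ i"]
    by (simp add: matrix_vector_mult_def axis_def if_distrib cong: if_cong)
  obtain b where b: "b \<in> S" "M *v vec 1 = b *s vec 1"
    using assms[of "vec 1"] by (auto simp: vec_eq_iff)
  have "c i = b" for i
    using arg_cong[OF b(2), of "\<lambda>v. v $ i"] by (simp add: matrix_vector_mult_def M)
  then have "M = mat b"
    by (simp add: vec_eq_iff M mat_def)
  with b(1) show ?thesis by blast
qed

lemma scalar_special_unitary:
  assumes "special_unitary_matrix (mat c :: complex^'n^'n)"
  obtains j :: nat where "c = cis (2 * pi * (real j / real CARD('n)))"
proof -
  have "c ^ CARD('n) = 1"
    using assms by (simp add: special_unitary_matrix_def det_mat)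
  then have "c \<in> (\<lambda>k. cis (2 * pi * real k / real CARD('n))) ` {..<CARD('n)}"
    using Complex.bij_betw_roots_unity[of "CARD('n)"] by (simp add: bij_betw_def)
  then show thesis
    using that by (auto simp: times_divide_eq_right)
qed

lemma special_unitary_mat_cis:
  "special_unitary_matrix (mat (cis (2 * pi * (of_int j / real CARD('n)))) :: complex^'n^'n)"
proof -
  have "real CARD('n) * (2 * pi * (of_int j / real CARD('n))) = 2 * pi * of_int j"
    by simp
  then show ?thesis
    unfolding special_unitary_matrix_def det_mat Complex.DeMoivre
    by (simp only: unitary_mat_cis cis_2pi_eq_1_iff Ints_of_int)
qed

lemma norm_real_cpow: "norm (real_cpow d x) = norm d powr x"
  by (simp add: real_cpow_def norm_mult)

text \<open>Scalar matrices commute with everything, so conjugating back leaves them unchanged. This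
  supplies \<open>D_eq_mat\<close> below.\<close>

lemma conjugation_eq_matD:
  fixes C :: "complex^'n^'n"
  assumes "invertible C" "C ** B ** matrix_inv C = mat c"
  shows "B = mat c"
proof -
  have "C ** matrix_inv C = mat 1" and inv: "matrix_inv C ** C = mat 1"
    using assms(1) unfolding invertible_def matrix_inv_def
    by (metis (mono_tags, lifting) someI_ex)+
  have "B = matrix_inv C ** (C ** B ** matrix_inv C) ** C"
    by (metis inv matrix_mul_assoc matrix_mul_lid matrix_mul_rid)
  also have "\<dots> = mat c"
    unfolding assms(2) by (metis inv mat_commute matrix_mul_assoc matrix_mul_rid)
  finally show ?thesis .
qed

text \<open>Treats both families at once: the sign \<epsilon> separates \<open>B\<close> from its
  conjugate, and \<open>s\<close> stands for p + q/m. \<open>D_eq_mat\<close> lets scalarity pass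
  from \<open>D B\<close> back to \<open>B\<close>.\<close>

locale hopf_twisted_action = twisted_action d m g D \<epsilon>
  for d :: complex and m :: nat and g :: "real \<Rightarrow> complex"
    and D :: "complex^'n^'n \<Rightarrow> complex^'n^'n" and \<epsilon> :: real +
  fixes s :: real and r :: int
  assumes norm_d: "norm d \<noteq> 1" and r: "r \<noteq> 0"
    and sign: "\<epsilon> = 1 \<or> \<epsilon> = - 1"
    and g_eq: "g t = cis ((\<epsilon> + s * real CARD('n)) * t)
      * real_cpow d (real CARD('n) * of_int r * t / (2 * pi))"
    and D_eq_mat: "D B = mat c \<Longrightarrow> \<exists>b. B = mat b"
begin

section \<open>Elements acting trivially and the arithmetic conditions\<close>

lemma Ints_sign_mult_iff: "\<epsilon> * x \<in> \<int> \<longleftrightarrow> x \<in> \<int>"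
  using sign by auto

text \<open>A class is fixed iff \<open>z\<close> is multiplied by an element of the group
  \<open>?S\<close> generated by d and e^(2 pi i/m); \<open>K\<close> stays an arbitrary integer
  here.\<close>

lemma fixes_all_iff:
  assumes B: "special_unitary_matrix B"
  shows "(\<forall>X\<in>hopf_quot d m. induced_action d m F (mat (cis t) ** B) X = X) \<longleftrightarrow>
    (\<exists>k K :: int. mat (g t) ** D B = mat ((d powi k) * cis (2 * pi * (of_int K / real m))))"
    (is "?L \<longleftrightarrow> ?R")
proof -
  let ?S = "{(d powi k) * cis (2 * pi * (of_int K / real m)) | k K :: int. True}"
  have F: "F t B z = (mat (g t) ** D B) *v z" for z
    by (simp flip: matrix_vector_mul_assoc)
  have "?L \<longleftrightarrow> (\<forall>z. z \<noteq> 0 \<longrightarrow> hopf_quot_class d m z = hopf_quot_class d m (F t B z))"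
    using B by (auto simp: hopf_quot_eq induced_action_eq)
  also have "\<dots> \<longleftrightarrow> (\<forall>z. z \<noteq> 0 \<longrightarrow> (\<exists>c\<in>?S. F t B z = c *s z))"
  proof (intro all_cong1 imp_cong refl)
    fix z :: "complex^'n" assume "z \<noteq> 0"
    then show "hopf_quot_class d m z = hopf_quot_class d m (F t B z) \<longleftrightarrow> (\<exists>c\<in>?S. F t B z = c *s z)"
      unfolding hopf_quot_class_eq_iff[OF d m \<open>z \<noteq> 0\<close> F_nonzero[OF B \<open>z \<noteq> 0\<close>]]
      by (simp only: times_divide_eq_right) blast
  qed
  \<comment> \<open>The quantifiers are exchanged: one element of \<open>?S\<close> serves all
    \<open>z\<close>.\<close>
  also have "\<dots> \<longleftrightarrow> (\<exists>c\<in>?S. mat (g t) ** D B = mat c)"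
  proof
    assume "\<forall>z. z \<noteq> 0 \<longrightarrow> (\<exists>c\<in>?S. F t B z = c *s z)"
    then show "\<exists>c\<in>?S. mat (g t) ** D B = mat c"
      unfolding F by (intro matrix_eq_mat_of_eigenvectors) blast
  next
    assume "\<exists>c\<in>?S. mat (g t) ** D B = mat c"
    then show "\<forall>z. z \<noteq> 0 \<longrightarrow> (\<exists>c\<in>?S. F t B z = c *s z)"
      unfolding F by (metis mat_mult_vec)
  qed
  also have "\<dots> \<longleftrightarrow> ?R"
    by blast
  finally show ?thesis .
qed

text \<open>The exponents \<open>l\<close> and \<open>K\<close> of the scalar by which the element
  acts form the required pair.\<close>

lemma kernel_imp_pair:
  assumes B: "special_unitary_matrix B"
    and fixes_all: "\<forall>X\<in>hopf_quot d m. induced_action d m F (mat (cis t) ** B) X = X"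
    and nontrivial: "mat (cis t) ** B \<noteq> mat 1"
  obtains l K :: int where
    "of_int l / of_int r * (\<epsilon> + s * real CARD('n)) - real CARD('n) * of_int K / real m \<in> \<int>"
    "of_int l / of_int r * s - of_int K / real m \<notin> \<int>"
proof -
  obtain l K :: int where lK: "mat (g t) ** D B = mat ((d powi l) * cis (2 * pi * (of_int K / real m)))"
    using fixes_all unfolding fixes_all_iff[OF B] by blast
  have "D B = mat (inverse (g t)) ** (mat (g t) ** D B)"
    using g_nonzero[of t] by (simp add: matrix_mul_assoc mat_mult_mat)
  also have "\<dots> = mat (inverse (g t) * ((d powi l) * cis (2 * pi * (of_int K / real m))))"
    by (simp only: lK mat_mult_mat)
  finally obtain b where "B = mat b"
    using D_eq_mat by blast
  with B obtain j :: nat where j: "B = mat (cis (2 * pi * (real j / real CARD('n))))"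
    using scalar_special_unitary by blast
  have "mat (g t * cis (\<epsilon> * (2 * pi * (real j / real CARD('n)))))
      = (mat ((d powi l) * cis (2 * pi * (of_int K / real m))) :: complex^'n^'n)"
    using lK by (simp only: j D_scalar mat_mult_mat)
  then have eq: "g t * cis (\<epsilon> * (2 * pi * (real j / real CARD('n))))
      = (d powi l) * cis (2 * pi * (of_int K / real m))"
    by (simp only: mat_eq_iff)
  \<comment> \<open>All \<open>cis\<close> factors have modulus 1, and
    \<open>norm d \<noteq> 1\<close> makes the remaining powers injective in the exponent.\<close>
  have "norm d powr (real CARD('n) * of_int r * t / (2 * pi)) = norm d powr of_int l"
    using arg_cong[OF eq, of norm] d
    by (simp add: g_eq norm_mult norm_real_cpow norm_power_int powr_real_of_int')
  then have nrt: "real CARD('n) * of_int r * t / (2 * pi) = of_int l"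
    using d norm_d by (simp add: powr_inj)
  then have t: "t = 2 * pi * (of_int l / (real CARD('n) * of_int r))"
    using r by (simp add: field_simps)
  \<comment> \<open>In full turns, the argument of the \<open>cis\<close> factor of
    \<open>g t\<close> relative to e^(2 pi i K/m); n * x is the first expression of the
    pair.\<close>
  define x where "x = of_int l / (real CARD('n) * of_int r) * (\<epsilon> + s * real CARD('n)) - of_int K / real m"
  \<comment> \<open>The exponent of \<open>real_cpow\<close> is the integer \<open>l\<close>, so
    both sides share the factor \<open>d powi l\<close>.\<close>
  have "(d powi l) * (cis ((\<epsilon> + s * real CARD('n)) * t) * cis (\<epsilon> * (2 * pi * (real j / real CARD('n)))))
      = (d powi l) * cis (2 * pi * (of_int K / real m))"
    using eq unfolding g_eq nrt real_cpow_int[OF d] by (simp only: mult_ac)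
  then have "cis ((\<epsilon> + s * real CARD('n)) * t) * cis (\<epsilon> * (2 * pi * (real j / real CARD('n))))
      = cis (2 * pi * (of_int K / real m))"
    using d by simp
  then have "cis (2 * pi * (of_int l / (real CARD('n) * of_int r) * (\<epsilon> + s * real CARD('n))
        + \<epsilon> * (real j / real CARD('n)))) = cis (2 * pi * (of_int K / real m))"
    unfolding cis_mult t by (simp only: distrib_left mult_ac)
  then have xj: "x + \<epsilon> * (real j / real CARD('n)) \<in> \<int>"
    unfolding cis_2pi_eq_iff by (simp add: x_def algebra_simps)
  show thesis
  proof (rule that)
    have "real CARD('n) * (x + \<epsilon> * (real j / real CARD('n))) - \<epsilon> * real j \<in> \<int>"
      using xj by (simp only: Ints_diff Ints_mult Ints_of_nat Ints_sign_mult_iff)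
    also have "real CARD('n) * (x + \<epsilon> * (real j / real CARD('n))) - \<epsilon> * real j
        = of_int l / of_int r * (\<epsilon> + s * real CARD('n)) - real CARD('n) * of_int K / real m"
      using r by (simp add: x_def distrib_left right_diff_distrib)
    finally show "of_int l / of_int r * (\<epsilon> + s * real CARD('n)) - real CARD('n) * of_int K / real m \<in> \<int>" .
    show "of_int l / of_int r * s - of_int K / real m \<notin> \<int>"
    proof
      assume "of_int l / of_int r * s - of_int K / real m \<in> \<int>"
      \<comment> \<open>The difference of these two integers is, up to sign, the argument of the
        scalar matrix \<open>mat (cis t) ** B\<close> in full turns, so that matrix would be the
        identity.\<close>
      then have "x + \<epsilon> * (real j / real CARD('n)) - (of_int l / of_int r * s - of_int K / real m) \<in> \<int>"
        by (rule Ints_diff[OF xj])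
      also have "x + \<epsilon> * (real j / real CARD('n)) - (of_int l / of_int r * s - of_int K / real m)
          = \<epsilon> * (of_int l / (real CARD('n) * of_int r) + real j / real CARD('n))"
        using r by (simp add: x_def field_simps)
      finally have "of_int l / (real CARD('n) * of_int r) + real j / real CARD('n) \<in> \<int>"
        by (simp only: Ints_sign_mult_iff)
      then have "mat (cis t) ** B = mat 1"
        unfolding j t mat_mult_mat cis_mult by (simp only: mat_eq_iff cis_2pi_eq_1_iff flip: distrib_left)
      with nontrivial show False by blast
    qed
  qed
qed

text \<open>The witness is a scalar matrix: \<open>t\<close> is chosen so that
  \<open>real_cpow\<close> contributes \<open>d powi l\<close>, and \<open>B\<close> is an n-th root
  of unity correcting the remaining argument.\<close>

lemma pair_imp_kernel:
  fixes l K :: int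
  assumes 1: "of_int l / of_int r * (\<epsilon> + s * real CARD('n)) - real CARD('n) * of_int K / real m \<in> \<int>"
    and 2: "of_int l / of_int r * s - of_int K / real m \<notin> \<int>"
  obtains A where "unitary_matrix A" "A \<noteq> mat 1"
    "\<forall>X\<in>hopf_quot d m. induced_action d m F A X = X"
proof -
  define x where "x = of_int l / (real CARD('n) * of_int r) * (\<epsilon> + s * real CARD('n)) - of_int K / real m"
  have nx: "real CARD('n) * x
      = of_int l / of_int r * (\<epsilon> + s * real CARD('n)) - real CARD('n) * of_int K / real m"
    using r by (simp add: x_def right_diff_distrib)
  \<comment> \<open>As \<epsilon> squares to 1, this choice of \<open>j\<close> makes the argument
    contributed by \<open>D B\<close> cancel \<open>x\<close>.\<close>
  have "- \<epsilon> * (real CARD('n) * x) \<in> \<int>"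
    using Ints_minus[OF 1] nx[symmetric] 1 sign by auto
  then obtain j :: int where j: "- \<epsilon> * (real CARD('n) * x) = of_int j"
    by (rule Ints_cases)
  then have "\<epsilon> * of_int j = - (real CARD('n) * x)"
    using sign by auto
  then have x: "\<epsilon> * (of_int j / real CARD('n)) = - x"
    by (simp add: field_simps)
  define t where "t = 2 * pi * (of_int l / (real CARD('n) * of_int r))"
  define B :: "complex^'n^'n" where "B = mat (cis (2 * pi * (of_int j / real CARD('n))))"
  have B: "special_unitary_matrix B"
    unfolding B_def by (rule special_unitary_mat_cis)
  have "real CARD('n) * of_int r * t / (2 * pi) = of_int l"
    using r by (simp add: t_def)
  then have "mat (g t) ** D B = mat ((d powi l) * (cis ((\<epsilon> + s * real CARD('n)) * t)
      * cis (2 * pi * (\<epsilon> * (of_int j / real CARD('n))))))"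
    by (simp add: B_def D_scalar mat_mult_mat g_eq real_cpow_int[OF d] mult_ac)
  also have "cis ((\<epsilon> + s * real CARD('n)) * t) * cis (2 * pi * (\<epsilon> * (of_int j / real CARD('n))))
      = cis (2 * pi * (of_int K / real m))"
    unfolding x cis_mult by (rule arg_cong[of _ _ cis]) (simp add: x_def t_def algebra_simps)
  finally have fixes_all: "\<forall>X\<in>hopf_quot d m. induced_action d m F (mat (cis t) ** B) X = X"
    unfolding fixes_all_iff[OF B] by blast
  have "mat (cis t) ** B \<noteq> mat 1"
  proof
    assume "mat (cis t) ** B = mat 1"
    then have "mat (cis (2 * pi * (of_int l / (real CARD('n) * of_int r) + of_int j / real CARD('n))))
        = (mat 1 :: complex^'n^'n)"
      by (simp only: B_def t_def mat_mult_mat cis_mult distrib_left)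
    then have "of_int l / (real CARD('n) * of_int r) + of_int j / real CARD('n) \<in> \<int>"
      unfolding cis_2pi_eq_1_iff[symmetric] by (simp only: mat_eq_iff)
    \<comment> \<open>With \<epsilon>j/n = -x this integer turns into the second expression of the
      pair, contradicting the hypothesis on it.\<close>
    then have "- (\<epsilon> * (of_int l / (real CARD('n) * of_int r) + of_int j / real CARD('n))) \<in> \<int>"
      by (simp only: Ints_sign_mult_iff Ints_minus)
    also have "- (\<epsilon> * (of_int l / (real CARD('n) * of_int r) + of_int j / real CARD('n)))
        = x - \<epsilon> * (of_int l / (real CARD('n) * of_int r))"
      unfolding distrib_left x by simp
    also have "\<dots> = of_int l / of_int r * s - of_int K / real m"
      using r by (simp add: x_def field_simps)
    finally show False using 2 by blast
  qed
  moreover have "unitary_matrix (mat (cis t) ** B)"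
    using B by (simp add: special_unitary_matrix_def unitary_mult unitary_mat_cis)
  ultimately show thesis
    using that fixes_all by blast
qed

text \<open>Replacing \<open>K\<close> by its residue changes K/m by an integer and nK/m by n times
  that integer, so both conditions persist.\<close>

lemma pair_reduce_mod:
  fixes l K :: int
  assumes "of_int l / of_int r * (\<epsilon> + s * real CARD('n)) - real CARD('n) * of_int K / real m \<in> \<int>"
    and "of_int l / of_int r * s - of_int K / real m \<notin> \<int>"
  obtains K' :: nat where "K' < m"
    "of_int l / of_int r * (\<epsilon> + s * real CARD('n)) - real CARD('n) * of_nat K' / real m \<in> \<int>"
    "of_int l / of_int r * s - of_nat K' / real m \<notin> \<int>"
proof
  let ?K' = "nat (K mod int m)"
  show "?K' < m"
    using m by (simp add: nat_less_iff)
  have "real_of_int K = of_int (K div int m) * real m + of_int (K mod int m)"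
    by (metis div_mult_mod_eq of_int_add of_int_mult of_int_of_nat_eq)
  then have K: "of_int K / real m = of_int (K div int m) + real ?K' / real m"
    using m by (simp add: field_simps)
  have nK: "real CARD('n) * of_int K / real m
      = real CARD('n) * of_int (K div int m) + real CARD('n) * real ?K' / real m"
    using K by (simp only: distrib_left flip: times_divide_eq_right)
  have "of_int l / of_int r * (\<epsilon> + s * real CARD('n)) - real CARD('n) * of_nat ?K' / real m
      = (of_int l / of_int r * (\<epsilon> + s * real CARD('n)) - real CARD('n) * of_int K / real m)
        + real CARD('n) * of_int (K div int m)"
    unfolding nK by simp
  then show "of_int l / of_int r * (\<epsilon> + s * real CARD('n)) - real CARD('n) * of_nat ?K' / real m \<in> \<int>"
    using assms(1) by (simp only: Ints_add Ints_mult Ints_of_nat Ints_of_int)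
  have "of_int l / of_int r * s - of_int K / real m
      = (of_int l / of_int r * s - of_nat ?K' / real m) - of_int (K div int m)"
    unfolding K by simp
  then show "of_int l / of_int r * s - of_nat ?K' / real m \<notin> \<int>"
    using assms(2) by (metis Ints_diff Ints_of_int)
qed

text \<open>The maps already form a group action, so effectiveness means a trivial kernel. Since m >
  0, the range \<open>{0..m - 1}\<close> in natural numbers is \<open>K < m\<close>.\<close>

lemma effective_iff:
  "effective_action unitary_group (hopf_quot d m) (induced_action d m F) \<longleftrightarrow>
    \<not> (\<exists>(l::int) (K::nat). K \<in> {0..m - 1} \<and>
      of_int l / of_int r * (\<epsilon> + s * real CARD('n)) - real CARD('n) * of_nat K / of_nat m \<in> \<int> \<and>
      of_int l / of_int r * s - of_nat K / of_nat m \<notin> \<int>)"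
    (is "?E \<longleftrightarrow> \<not> ?P")
proof -
  have E: "?E \<longleftrightarrow> (\<forall>A. unitary_matrix A \<and>
      (\<forall>X\<in>hopf_quot d m. induced_action d m F A X = X) \<longrightarrow> A = mat 1)"
    using group_action_induced by (auto simp: effective_action_def unitary_group_def)
  show ?thesis
  proof
    assume ?E
    show "\<not> ?P"
    proof
      assume ?P
      then obtain l :: int and K :: nat where
        "of_int l / of_int r * (\<epsilon> + s * real CARD('n)) - real CARD('n) * of_int (int K) / of_nat m \<in> \<int>"
        "of_int l / of_int r * s - of_int (int K) / of_nat m \<notin> \<int>"
        by auto
      then obtain A where "unitary_matrix A" "A \<noteq> mat 1"
          "\<forall>X\<in>hopf_quot d m. induced_action d m F A X = X"
        by (rule pair_imp_kernel)
      with \<open>?E\<close> E show False by blast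
    qed
  next
    assume "\<not> ?P"
    show ?E
      unfolding E
    proof (intro allI impI, elim conjE, rule ccontr)
      fix A assume A: "unitary_matrix A" "A \<noteq> mat 1"
        and fixes_all: "\<forall>X\<in>hopf_quot d m. induced_action d m F A X = X"
      obtain t B where B: "special_unitary_matrix B" "A = mat (cis t) ** B"
        using unitary_decomposition[OF A(1)] .
      obtain l K :: int where
        "of_int l / of_int r * (\<epsilon> + s * real CARD('n)) - real CARD('n) * of_int K / real m \<in> \<int>"
        "of_int l / of_int r * s - of_int K / real m \<notin> \<int>"
        using kernel_imp_pair[OF B(1) fixes_all[unfolded B(2)] A(2)[unfolded B(2)]] .
      then obtain K' :: nat where "K' < m"
        "of_int l / of_int r * (\<epsilon> + s * real CARD('n)) - real CARD('n) * of_nat K' / real m \<in> \<int>"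
        "of_int l / of_int r * s - of_nat K' / real m \<notin> \<int>"
        by (rule pair_reduce_mod)
      with \<open>\<not> ?P\<close> show False by auto
    qed
  qed
qed

end

section \<open>The two families of actions as instances\<close>

theorem proposition1p5:
  fixes d :: complex and m :: nat and p q r :: int and C :: "complex^'n^'n"
  assumes "CARD('n) \<ge> 2"
    and "d \<noteq> 0" and "norm d \<noteq> 1"
    and "m > 0"
    and "r \<noteq> 0"
    and "invertible C"
  shows "(effective_action unitary_group (hopf_quot d m) (unitary_action d m p q r C)
      \<longleftrightarrow> \<not> (\<exists>(l::int) (K::nat). K \<in> {0..m - 1} \<and>
        (of_int l / of_int r * (1 + (of_int p + of_int q / of_nat m) * real CARD('n))
          - real CARD('n) * of_nat K / of_nat m :: real) \<in> \<int> \<and>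
        (of_int l / of_int r * (of_int p + of_int q / of_nat m) - of_nat K / of_nat m :: real) \<notin> \<int>))
    \<and> (effective_action unitary_group (hopf_quot d m) (unitary_action_cnj d m p q r C)
      \<longleftrightarrow> \<not> (\<exists>(l::int) (K::nat). K \<in> {0..m - 1} \<and>
        (of_int l / of_int r * (- 1 + (of_int p + of_int q / of_nat m) * real CARD('n))
          - real CARD('n) * of_nat K / of_nat m :: real) \<in> \<int> \<and>
        (of_int l / of_int r * (of_int p + of_int q / of_nat m) - of_nat K / of_nat m :: real) \<notin> \<int>))"
proof
  interpret hopf_twisted_action d m
      "\<lambda>t. cis ((1 + (of_int p + of_int q / of_nat m) * real CARD('n)) * t)
        * real_cpow d (real CARD('n) * of_int r * t / (2 * pi))"
      "\<lambda>B. C ** B ** matrix_inv C" 1 "of_int p + of_int q / of_nat m" r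
    using assms conjugation_eq_matD
    by (intro hopf_twisted_action.intro twisted_action1 hopf_twisted_action_axioms.intro) auto
  show "effective_action unitary_group (hopf_quot d m) (unitary_action d m p q r C)
      \<longleftrightarrow> \<not> (\<exists>(l::int) (K::nat). K \<in> {0..m - 1} \<and>
        (of_int l / of_int r * (1 + (of_int p + of_int q / of_nat m) * real CARD('n))
          - real CARD('n) * of_nat K / of_nat m :: real) \<in> \<int> \<and>
        (of_int l / of_int r * (of_int p + of_int q / of_nat m) - of_nat K / of_nat m :: real) \<notin> \<int>)"
    unfolding unitary_action_def by (rule effective_iff)
next
  \<comment> \<open>Needed for \<open>D_eq_mat\<close> in the second family: after the conjugation
    by \<open>C\<close> is undone, the entrywise complex conjugation remains, an involution
    preserving scalar matrices.\<close>
  have cnj_scalar: "\<exists>b. B = mat b" if "map_matrix cnj B = mat c" for B :: "complex^'n^'n" and c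
  proof
    have "B = map_matrix cnj (map_matrix cnj B)"
      by (simp add: vec_eq_iff)
    then show "B = mat (cnj c)"
      unfolding that map_cnj_mat .
  qed
  interpret hopf_twisted_action d m
      "\<lambda>t. cis ((- 1 + (of_int p + of_int q / of_nat m) * real CARD('n)) * t)
        * real_cpow d (real CARD('n) * of_int r * t / (2 * pi))"
      "\<lambda>B. C ** map_matrix cnj B ** matrix_inv C" "- 1" "of_int p + of_int q / of_nat m" r
    using assms conjugation_eq_matD cnj_scalar
    by (intro hopf_twisted_action.intro twisted_action2 hopf_twisted_action_axioms.intro) blast+
  show "effective_action unitary_group (hopf_quot d m) (unitary_action_cnj d m p q r C)
      \<longleftrightarrow> \<not> (\<exists>(l::int) (K::nat). K \<in> {0..m - 1} \<and>
        (of_int l / of_int r * (- 1 + (of_int p + of_int q / of_nat m) * real CARD('n))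
          - real CARD('n) * of_nat K / of_nat m :: real) \<in> \<int> \<and>
        (of_int l / of_int r * (of_int p + of_int q / of_nat m) - of_nat K / of_nat m :: real) \<notin> \<int>)"
    unfolding unitary_action_cnj_def by (rule effective_iff)
qed

end
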